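(* A random time $\tau$ is a $\mathbb{G}$-stopping time if and only if it has the decomposition $$\tau=\tau^0 1_{\{\tau^0<\zeta_1\}}+\sum_{k=1}^{n-1}\tau^k(\pmb\zeta_k,\pmb\ell_k)\, 1_{\{\tau^0\geq\zeta_1\}\cap\dots\cap\{\tau^{k-1}\geq\zeta_k\}\cap\{\tau^k <\zeta_{k+1}\}}+\tau^n(\pmb\zeta_n,\pmb\ell_n)\, 1_{\{\tau^0\geq\zeta_1\}\cap\dots\cap\{\tau^{n-1}\geq\zeta_n\}}$$ for some $(\tau^0,\dots,\tau^n)$, where $\tau^0$ is an $\mathbb{F}$-stopping time and, for $k=1,\dots,n$, $\tau^k=\tau^k(\pmb\zeta_k,\pmb\ell_k)$ is a $\mathbb{G}^k$-stopping time satisfying $\tau^k(\pmb\zeta_k,\pmb\ell_k)\geq\zeta_k$.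
   Context: Probabilistic setting. On a probability space $(\Omega,\mathbb{P})$, $\mathbb{F}=(\mathcal{F}_t)_{t\ge 0}$ is the filtration generated by a Brownian motion, satisfying the usual conditions. There are at most $n\ge 1$ jumps: $0\le\zeta_1\le\dots\le\zeta_n$ are random (jump) times and $\ell_1,\dots,\ell_n$ are random marks valued in a Borel subset $E$ of $\mathbb{R}^{\hat d}$. Write $\pmb\zeta_k=(\zeta_1,\dots,\zeta_k)$, $\pmb\ell_k=(\ell_1,\dots,\ell_k)$. For $k=0,\dots,n$ let $$\mathcal{D}^{k}_t=\bigvee_{i=1}^{k}\big(\sigma(1_{\{\zeta_i\leq s\}},\ s\leq t)\vee\sigma(\ell_i1_{\{\zeta_i\leq s\}},\ s\leq t)\big),\qquad \mathcal{G}^k_t=\mathcal{F}_t\vee\mathcal{D}^k_t,$$ $\mathbb{G}^k=(\mathcal{G}^k_t)_{t\ge0}$ (so $\mathbb{G}^0=\mathbb{F}$), and $\mathbb{G}=\mathbb{G}^n$, $\mathcal G_t=\mathcal G^n_t$. These filtrations are not assumed to be right-continuous. A $\mathbb{G}^k$-stopping time is a $[0,\infty]$-valued random time $\tau$ with $\{\tau\le t\}\in\mathcal{G}^k_t$ for all $t\ge 0$. Notation: a $\mathcal{G}^k_\infty$-measurable random variable $X$ is written $X(\pmb\zeta_k,\pmb\ell_k)$ to stress that it is a function of the Brownian path and of $(\pmb\zeta_k,\pmb\ell_k)$. *)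

theory Defs
  imports "HOL-Probability.Probability"
begin

text \<open>
  \<^bold>\<open>Time index.\<close> Random times take values in \<open>[0,\<infinity>]\<close>, i.e. in \<^typ>\<open>ennreal\<close>. Since the library's
  \<^const>\<open>stopping_time\<close> requires a stopping time to take its values in the index type of the
  filtration, all filtrations below are indexed by \<^typ>\<open>ennreal\<close>. The generators involve finite
  times only, so index \<open>\<infinity>\<close> just gives the terminal sigma-algebra. It puts no constraint on
  stopping times; see \<open>stopping_time_ennreal_iff\<close>.
\<close>

definition generated_algebra ::
  "'a set \<Rightarrow> 'i set \<Rightarrow> ('i \<Rightarrow> 'a \<Rightarrow> 'b::topological_space) \<Rightarrow> 'a measure" where
  "generated_algebra \<Omega> I X = sigma \<Omega> (\<Union>i\<in>I. sets (vimage_algebra \<Omega> (X i) borel))"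

text \<open>Standard Brownian motion with values in a Euclidean space. Increments over \<open>[s,t]\<close> are
  centred Gaussian with covariance \<open>(t - s)\<close> times the identity, expressed by the product density.\<close>

definition brownian_motion :: "'a measure \<Rightarrow> (real \<Rightarrow> 'a \<Rightarrow> 'b::euclidean_space) \<Rightarrow> bool" where
  "brownian_motion M W \<longleftrightarrow>
     prob_space M \<and>
     (\<forall>t\<ge>0. W t \<in> borel_measurable M) \<and>
     (AE \<omega> in M. W 0 \<omega> = 0) \<and>
     (AE \<omega> in M. continuous_on {0..} (\<lambda>t. W t \<omega>)) \<and>
     (\<forall>s t. 0 \<le> s \<longrightarrow> s < t \<longrightarrow>
        distributed M lborel (\<lambda>\<omega>. W t \<omega> - W s \<omega>)
          (\<lambda>x. ennreal (\<Prod>b\<in>Basis. normal_density 0 (sqrt (t - s)) (x \<bullet> b)))) \<and>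
     (\<forall>(m::nat) u. 0 \<le> u 0 \<longrightarrow> (\<forall>i<m. u i < u (Suc i)) \<longrightarrow>
        prob_space.indep_vars M (\<lambda>_. borel) (\<lambda>i \<omega>. W (u (Suc i)) \<omega> - W (u i) \<omega>) {..<m})"

definition completed_natural_filtration ::
  "'a measure \<Rightarrow> (real \<Rightarrow> 'a \<Rightarrow> 'b::topological_space) \<Rightarrow> ennreal \<Rightarrow> 'a measure" where
  "completed_natural_filtration M W t =
     sigma (space M)
       (sets (generated_algebra (space M) {u. 0 \<le> u \<and> ennreal u \<le> t} W) \<union> null_sets M)"

text \<open>The filtration generated by \<open>W\<close> under the usual conditions (null sets adjoined, then made
  right-continuous). For \<open>t < \<infinity>\<close> the member \<open>s = \<infinity>\<close> of the intersection is redundant; it makes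
  the definition give the terminal sigma-algebra for \<open>t = \<infinity>\<close>.\<close>

definition usual_filtration ::
  "'a measure \<Rightarrow> (real \<Rightarrow> 'a \<Rightarrow> 'b::topological_space) \<Rightarrow> ennreal \<Rightarrow> 'a measure" where
  "usual_filtration M W t =
     sigma (space M) (\<Inter>s\<in>{s. t < s \<or> s = \<infinity>}. sets (completed_natural_filtration M W s))"

definition jump_filtration ::
  "'a set \<Rightarrow> (nat \<Rightarrow> 'a \<Rightarrow> ennreal) \<Rightarrow> (nat \<Rightarrow> 'a \<Rightarrow> 'e::euclidean_space) \<Rightarrow> nat \<Rightarrow> ennreal \<Rightarrow> 'a measure"
  where
  "jump_filtration \<Omega> \<zeta> \<l> k t =
     sigma \<Omega> (\<Union>i\<in>{1..k}.
       sets (generated_algebra \<Omega> {s. 0 \<le> s \<and> ennreal s \<le> t}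
         (\<lambda>s \<omega>. indicator {\<omega>'. \<zeta> i \<omega>' \<le> ennreal s} \<omega> :: real)) \<union>
       sets (generated_algebra \<Omega> {s. 0 \<le> s \<and> ennreal s \<le> t}
         (\<lambda>s \<omega>. indicator {\<omega>'. \<zeta> i \<omega>' \<le> ennreal s} \<omega> *\<^sub>R \<l> i \<omega>)))"

definition enlarged_filtration ::
  "'a measure \<Rightarrow> (real \<Rightarrow> 'a \<Rightarrow> 'b::topological_space) \<Rightarrow>
   (nat \<Rightarrow> 'a \<Rightarrow> ennreal) \<Rightarrow> (nat \<Rightarrow> 'a \<Rightarrow> 'e::euclidean_space) \<Rightarrow> nat \<Rightarrow> ennreal \<Rightarrow> 'a measure"
  where
  "enlarged_filtration M W \<zeta> \<l> k t =
     sigma (space M)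
       (sets (usual_filtration M W t) \<union> sets (jump_filtration (space M) \<zeta> \<l> k t))"

lemma stopping_time_ennreal_iff:
  fixes F :: "ennreal \<Rightarrow> 'a measure"
  assumes "\<And>t. space (F t) = \<Omega>"
  shows "stopping_time F T \<longleftrightarrow> (\<forall>t::real. 0 \<le> t \<longrightarrow> {\<omega>\<in>\<Omega>. T \<omega> \<le> ennreal t} \<in> sets (F (ennreal t)))"
proof
  assume T: "stopping_time F T"
  show "\<forall>t::real. 0 \<le> t \<longrightarrow> {\<omega>\<in>\<Omega>. T \<omega> \<le> ennreal t} \<in> sets (F (ennreal t))"
    using stopping_timeD[OF T] unfolding pred_def assms by blast
next
  assume *: "\<forall>t::real. 0 \<le> t \<longrightarrow> {\<omega>\<in>\<Omega>. T \<omega> \<le> ennreal t} \<in> sets (F (ennreal t))"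
  show "stopping_time F T"
  proof
    fix t :: ennreal
    show "Measurable.pred (F t) (\<lambda>\<omega>. T \<omega> \<le> t)"
    proof (cases t)
      case (real r)
      then show ?thesis
        using * unfolding pred_def assms by blast
    next
      case top
      then show ?thesis
        by simp
    qed
  qed
qed

lemma space_completed_natural_filtration [simp]:
  "space (completed_natural_filtration M W t) = space M"
  unfolding completed_natural_filtration_def generated_algebra_def
  by (rule space_measure_of_conv)

lemma space_usual_filtration [simp]: "space (usual_filtration M W t) = space M"
  unfolding usual_filtration_def by (rule space_measure_of_conv)

lemma space_jump_filtration [simp]: "space (jump_filtration \<Omega> \<zeta> \<l> k t) = \<Omega>"
  unfolding jump_filtration_def by (rule space_measure_of_conv)

lemma space_enlarged_filtration [simp]: "space (enlarged_filtration M W \<zeta> \<l> k t) = space M"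
  unfolding enlarged_filtration_def by (rule space_measure_of_conv)

lemma sets_enlarged_filtration_0:
  "sets (enlarged_filtration M W \<zeta> \<l> 0 t) = sets (usual_filtration M W t)"
proof -
  have "sets (jump_filtration (space M) \<zeta> \<l> 0 t) = {{}, space M}"
    unfolding jump_filtration_def by (simp add: sigma_sets_empty_eq)
  moreover have "space M \<in> sets (usual_filtration M W t)"
    using sets.top[of "usual_filtration M W t"] by (simp only: space_usual_filtration)
  ultimately have un: "sets (usual_filtration M W t) \<union> sets (jump_filtration (space M) \<zeta> \<l> 0 t)
      = sets (usual_filtration M W t)"
    by auto
  have "sets (sigma (space (usual_filtration M W t)) (sets (usual_filtration M W t)))
      = sets (usual_filtration M W t)"
    by (subst sets_measure_of[OF sets.space_closed]) (rule sets.sigma_sets_eq)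
  then show ?thesis
    unfolding enlarged_filtration_def un by (simp only: space_usual_filtration)
qed

end

theory Submission
  imports Defs
begin

text \<open>
  Before \<open>\<zeta>\<^bsub>k+1\<^esub>\<close> the filtrations \<open>\<G>\<^sup>n\<close> and \<open>\<G>\<^sup>k\<close> have the same trace, so there are
  \<open>B\<^sub>t \<in> \<G>\<^sup>k\<^sub>t\<close> that agree with \<open>{\<tau> \<le> t}\<close> on \<open>{t < \<zeta>\<^bsub>k+1\<^esub>}\<close>, and \<open>\<tau>\<^sup>k\<close> should be the first
  time \<open>t\<close> with \<open>\<omega> \<in> B\<^sub>t\<close>. As \<open>\<G>\<^sup>k\<close> need not be right-continuous, an infimum over rational times
  need not be a stopping time, for two reasons. The set \<open>B\<^sub>t\<close> is arbitrary on \<open>{\<zeta>\<^bsub>k+1\<^esub> \<le> t}\<close>; this is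
  cured by taking it minimal, i.e. by intersecting it with the measurable hull of \<open>{t < \<zeta>\<^bsub>k+1\<^esub>}\<close>
  in \<open>\<G>\<^sup>k\<^sub>t\<close>. Moreover \<open>B\<^sub>t\<close> may charge an irrational time \<open>t\<close>; this is cured by an essential
  infimum over all times. Then \<open>{\<tau>\<^sup>k \<le> t}\<close> differs from a set of \<open>\<G>\<^sup>k\<^sub>t\<close> by a null set only, and
  all null sets belong to \<open>\<G>\<^sup>k\<^sub>t\<close>.
\<close>

section \<open>Essential unions and measurable hulls\<close>

text \<open>Countable subfamilies are compared by the measure of their union. The union of a
  maximizing sequence of them is again countable, so the supremum is attained, and since the measure
  is finite a further set can add only a null set to a maximal union.\<close>

lemma essential_Union:
  assumes "finite_measure M" and A: "\<And>i. i \<in> I \<Longrightarrow> A i \<in> sets M"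
  obtains J where "countable J" "J \<subseteq> I" "\<And>i. i \<in> I \<Longrightarrow> A i - (\<Union>j\<in>J. A j) \<in> null_sets M"
proof -
  interpret finite_measure M by fact
  define K where "K = {J. J \<subseteq> I \<and> countable J}"
  define g where "g J = emeasure M (\<Union>j\<in>J. A j)" for J
  have meas: "(\<Union>j\<in>J. A j) \<in> sets M" if "J \<in> K" for J
    using that A by (auto simp: K_def intro!: sets.countable_UN')
  have "{} \<in> K" by (simp add: K_def)
  then obtain f :: "nat \<Rightarrow> ennreal" where f: "range f \<subseteq> g ` K" "Sup (g ` K) = Sup (range f)"
    using ennreal_SUP_countable_SUP[of K g] by blast
  then have "\<forall>m. \<exists>J\<in>K. f m = g J" by blast
  then obtain J where J: "\<And>m. J m \<in> K" "\<And>m. f m = g (J m)" by metis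
  define J' where "J' = (\<Union>m. J m)"
  have J': "J' \<in> K" using J(1) by (auto simp: J'_def K_def)
  have "f m \<le> g J'" for m
    unfolding J(2) g_def using meas[OF J'] by (intro emeasure_mono) (auto simp: J'_def)
  then have max: "g L \<le> g J'" if "L \<in> K" for L
    using that f(2) by (metis SUP_least SUP_upper order_trans)
  have "A i - (\<Union>j\<in>J'. A j) \<in> null_sets M" if i: "i \<in> I" for i
  proof -
    have *: "A i - (\<Union>j\<in>J'. A j) \<in> sets M" using A[OF i] meas[OF J'] by simp
    have "emeasure M (A i - (\<Union>j\<in>J'. A j)) + g J'
        = emeasure M ((A i - (\<Union>j\<in>J'. A j)) \<union> (\<Union>j\<in>J'. A j))"
      unfolding g_def using * meas[OF J'] by (intro plus_emeasure) auto
    also have "\<dots> = g (insert i J')"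
      unfolding g_def by (rule arg_cong[where f = "emeasure M"]) auto
    also have "\<dots> \<le> 0 + g J'" using max[of "insert i J'"] J' i by (simp add: K_def)
    finally have "emeasure M (A i - (\<Union>j\<in>J'. A j)) = 0"
      by (simp add: g_def)
    with * show ?thesis by blast
  qed
  with J' show ?thesis by (intro that[of J']) (auto simp: K_def)
qed

text \<open>\<open>U\<close> is the complement of the essential union of all sets of
  \<open>H\<close> that meet \<open>Q\<close> in a null set. Up to null sets it is the smallest set
  of \<open>H\<close> covering \<open>Q\<close>, which itself need not lie in
  \<open>H\<close>.\<close>

lemma measurable_hull:
  assumes M: "finite_measure M" and H: "subalgebra M H" and Q: "Q \<in> sets M"
  obtains U where "U \<in> sets H" "Q - U \<in> null_sets M"
    "\<And>S. S \<in> sets H \<Longrightarrow> S \<inter> Q \<in> null_sets M \<Longrightarrow> S \<inter> U \<in> null_sets M"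
proof -
  define I where "I = {S \<in> sets H. S \<inter> Q \<in> null_sets M}"
  have HM: "sets H \<subseteq> sets M" "space H = space M"
    using H by (auto simp: subalgebra_def)
  obtain J where J: "countable J" "J \<subseteq> I" "\<And>S. S \<in> I \<Longrightarrow> S - \<Union>J \<in> null_sets M"
    using essential_Union[OF M, of I "\<lambda>S. S"] HM by (auto simp: I_def)
  have UJ: "\<Union>J \<in> sets H"
    using J(1,2) by (intro sets.countable_Union) (auto simp: I_def)
  show ?thesis
  proof (rule that[of "space M - \<Union>J"])
    show "space M - \<Union>J \<in> sets H"
      using UJ HM(2) sets.compl_sets[of "\<Union>J" H] by simp
    have "Q - (space M - \<Union>J) = (\<Union>S\<in>J. S \<inter> Q)"
      using sets.sets_into_space[OF Q] by auto
    also have "\<dots> \<in> null_sets M"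
      using J(1,2) by (intro null_sets_UN') (auto simp: I_def)
    finally show "Q - (space M - \<Union>J) \<in> null_sets M" .
    fix S assume S: "S \<in> sets H" "S \<inter> Q \<in> null_sets M"
    have "S \<inter> (space M - \<Union>J) = S - \<Union>J"
      using sets.sets_into_space[OF S(1)] HM(2) by auto
    then show "S \<inter> (space M - \<Union>J) \<in> null_sets M"
      using J(3)[of S] S by (simp add: I_def)
  qed
qed

section \<open>Stopping times of a filtration without right-continuity\<close>

text \<open>Applied with \<open>G k\<close> for \<open>H\<close> and the jump time of index
  \<open>Suc k\<close> for \<open>\<zeta>\<close>. The conclusion is what the decomposition asks
  for: \<open>\<sigma>\<close> falls before \<open>\<zeta>\<close> exactly when
  \<open>\<tau>\<close> does, and then the two agree.\<close>

lemma stopping_time_before: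
  fixes H :: "ennreal \<Rightarrow> 'a measure" and \<tau> \<zeta> :: "'a \<Rightarrow> ennreal"
  assumes M: "finite_measure M" and filt: "filtration (space M) H"
    and HM: "\<And>t. sets (H t) \<subseteq> sets M" and null: "\<And>t. null_sets M \<subseteq> sets (H t)"
    and [measurable]: "\<tau> \<in> borel_measurable M" "\<zeta> \<in> borel_measurable M"
    and trace: "\<And>t. \<exists>B\<in>sets (H t). \<forall>\<omega>\<in>space M. t < \<zeta> \<omega> \<longrightarrow> (\<omega> \<in> B \<longleftrightarrow> \<tau> \<omega> \<le> t)"
  shows "\<exists>\<sigma>. stopping_time H \<sigma> \<and>
    (\<forall>\<omega>\<in>space M. (\<tau> \<omega> < \<zeta> \<omega> \<longrightarrow> \<sigma> \<omega> = \<tau> \<omega>) \<and> (\<zeta> \<omega> \<le> \<tau> \<omega> \<longrightarrow> \<zeta> \<omega> \<le> \<sigma> \<omega>))"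
proof -
  interpret filtration "space M" H by fact
  define Q where "Q t = {\<omega>\<in>space M. t < \<zeta> \<omega>}" for t
  have Q: "Q t \<in> sets M" for t by (simp add: Q_def)
  have sub: "subalgebra M (H t)" for t
    using HM by (simp add: subalgebra_def space_F)
  obtain B where B: "\<And>t. B t \<in> sets (H t)"
    "\<And>t \<omega>. \<omega> \<in> space M \<Longrightarrow> t < \<zeta> \<omega> \<Longrightarrow> \<omega> \<in> B t \<longleftrightarrow> \<tau> \<omega> \<le> t"
    using trace by metis
  have "\<forall>t. \<exists>U. U \<in> sets (H t) \<and> Q t - U \<in> null_sets M \<and>
      (\<forall>S. S \<in> sets (H t) \<longrightarrow> S \<inter> Q t \<in> null_sets M \<longrightarrow> S \<inter> U \<in> null_sets M)"
    using measurable_hull[OF M sub Q] by metis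
  then obtain U where U: "\<And>t. U t \<in> sets (H t)" "\<And>t. Q t - U t \<in> null_sets M"
    "\<And>t S. S \<in> sets (H t) \<Longrightarrow> S \<inter> Q t \<in> null_sets M \<Longrightarrow> S \<inter> U t \<in> null_sets M"
    by metis
  define C where "C t = B t \<inter> U t" for t
  have C: "C t \<in> sets (H t)" for t using B(1) U(1) by (simp add: C_def)
  have CM: "C t \<in> sets M" for t using C HM by blast
  have C_mono: "C s \<in> sets (H t)" if "s \<le> t" for s t
    using C sets_F_mono[OF that] by blast

  obtain D0 :: "ennreal set" where D0: "countable D0"
    "\<And>X. open X \<Longrightarrow> X \<noteq> {} \<Longrightarrow> \<exists>d\<in>D0. d \<in> X"
    using countable_dense_setE by auto
  have dense: "\<exists>d\<in>D0. x < d \<and> d < y" if "x < y" for x y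
    using D0(2)[of "{x<..<y}"] that by (auto simp: dense)
  \<comment> \<open>Countably many of the events before time \<open>r\<close> cover each single one
    of them up to a null set. Using this only for \<open>r\<close> in the countable dense set
    \<open>D0\<close> keeps the collection of all chosen times countable.\<close>
  have "\<forall>r. \<exists>J. countable J \<and> J \<subseteq> {..<r} \<and> (\<forall>t<r. C t - (\<Union>q\<in>J. C q) \<in> null_sets M)"
  proof
    fix r
    show "\<exists>J. countable J \<and> J \<subseteq> {..<r} \<and> (\<forall>t<r. C t - (\<Union>q\<in>J. C q) \<in> null_sets M)"
      by (rule essential_Union[OF M, of "{..<r}" C]) (use CM in auto)
  qed
  then obtain J where J: "\<And>r. countable (J r)" "\<And>r. J r \<subseteq> {..<r}"
    "\<And>r t. t < r \<Longrightarrow> C t - (\<Union>q\<in>J r. C q) \<in> null_sets M"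
    by metis
  \<comment> \<open>With these times added, \<open>Inf {q \<in> D. \<omega> \<in> C q} \<le> t\<close> for almost every \<open>\<omega> \<in> C t\<close>, for each \<open>t\<close>, also outside \<open>D\<close>.\<close>
  define D where "D = (\<Union>r\<in>D0. J r) \<union> D0"
  have D: "countable D" using D0(1) J(1) by (auto simp: D_def)
  have CD: "countable {q\<in>D. P q}" for P using D by (rule countable_Collect)

  \<comment> \<open>The infimum of the empty set is \<infinity>. \<open>N\<close> gathers, over the
    countable set \<open>D\<close>, the points of \<open>Q q\<close> that the hull
    \<open>U q\<close> misses.\<close>
  define \<rho> where "\<rho> \<omega> = Inf {q\<in>D. \<omega> \<in> C q}" for \<omega>
  define N where "N = (\<Union>q\<in>D. Q q - U q)"
  have N: "N \<in> null_sets M" unfolding N_def using D U(2) by (intro null_sets_UN')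
  have C_imp: "\<tau> \<omega> \<le> q \<or> \<zeta> \<omega> \<le> q" if "\<omega> \<in> space M" "\<omega> \<in> C q" for \<omega> q
    using B(2)[of \<omega> q] that by (auto simp: C_def not_less)
  have \<rho>_lower: "min (\<tau> \<omega>) (\<zeta> \<omega>) \<le> \<rho> \<omega>" if "\<omega> \<in> space M" for \<omega>
    unfolding \<rho>_def by (intro Inf_greatest) (use C_imp[OF that] in \<open>auto simp: min_le_iff_disj\<close>)
  have \<rho>_upper: "\<rho> \<omega> \<le> \<tau> \<omega>" if \<omega>: "\<omega> \<in> space M" "\<omega> \<notin> N" and less: "\<tau> \<omega> < \<zeta> \<omega>" for \<omega>
  proof (rule ccontr)
    assume "\<not> \<rho> \<omega> \<le> \<tau> \<omega>"
    with less have "\<tau> \<omega> < min (\<rho> \<omega>) (\<zeta> \<omega>)" by simp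
    \<comment> \<open>At such a \<open>q\<close> the time \<open>\<tau>\<close> has passed and
      \<open>\<zeta>\<close> has not, so \<open>\<omega>\<close> lies in \<open>B q\<close> and,
      being outside \<open>N\<close>, also in \<open>U q\<close>.\<close>
    then obtain q where q: "q \<in> D0" "\<tau> \<omega> < q" "q < \<rho> \<omega>" "q < \<zeta> \<omega>"
      using dense by (metis min_less_iff_conj)
    then have "\<omega> \<in> C q" using \<omega> B(2)[of \<omega> q] by (auto simp: C_def N_def Q_def D_def)
    then have "\<rho> \<omega> \<le> q" unfolding \<rho>_def using q by (intro Inf_lower) (auto simp: D_def)
    with q show False by simp
  qed
  \<comment> \<open>Being at most \<open>t\<close> means being below each \<open>r\<close> in
    \<open>D0\<close> slightly above \<open>t\<close>, and each such comparison involves countably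
    many \<open>C q\<close> with \<open>q < r\<close>. The bound \<open>s\<close> limits the times
    involved, so the event is known at every \<open>s > t\<close>, though not yet at
    \<open>t\<close>.\<close>
  have \<rho>_le_iff: "\<rho> \<omega> \<le> t \<longleftrightarrow> (\<forall>r\<in>{r\<in>D0. t < r \<and> r \<le> s}. \<exists>q\<in>{q\<in>D. q < r}. \<omega> \<in> C q)"
    if ts: "t < s" for \<omega> t s
  proof
    assume "\<rho> \<omega> \<le> t"
    then show "\<forall>r\<in>{r\<in>D0. t < r \<and> r \<le> s}. \<exists>q\<in>{q\<in>D. q < r}. \<omega> \<in> C q"
      using le_less_trans[of "\<rho> \<omega>" t] by (auto simp: \<rho>_def Inf_less_iff)
  next
    assume *: "\<forall>r\<in>{r\<in>D0. t < r \<and> r \<le> s}. \<exists>q\<in>{q\<in>D. q < r}. \<omega> \<in> C q"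
    show "\<rho> \<omega> \<le> t"
    proof (rule ccontr)
      assume "\<not> \<rho> \<omega> \<le> t"
      with ts have "t < min (\<rho> \<omega>) s" by simp
      then obtain r where r: "r \<in> D0" "t < r" "r < \<rho> \<omega>" "r < s"
        using dense by (metis min_less_iff_conj)
      with * obtain q where "q \<in> D" "q < r" "\<omega> \<in> C q" by force
      then have "\<rho> \<omega> \<le> q" unfolding \<rho>_def by (intro Inf_lower) auto
      with \<open>q < r\<close> r show False by simp
    qed
  qed

  \<comment> \<open>Adaptedness of \<open>\<rho>\<close>\<close>
  have T: "{\<omega>\<in>space M. \<rho> \<omega> \<le> t} \<in> sets (H t)" for t
  proof (cases "t = \<top>")
    case True
    then show ?thesis using sets.top[of "H t"] by (simp add: space_F)
  next
    case False
    define T where "T = {\<omega>\<in>space M. \<rho> \<omega> \<le> t}"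
    define V where "V = (\<Union>q\<in>{q\<in>D. q \<le> t}. C q)"
    \<comment> \<open>\<open>V\<close> and \<open>C t\<close> are known at time \<open>t\<close>. On
      the remainder \<open>R\<close> the infimum equals \<open>t\<close> and is approached only by
      times of \<open>D\<close> after \<open>t\<close>. The aim is to show that \<open>R\<close> and
      \<open>C t - T\<close> are null.\<close>
    define R where "R = T - V - C t"
    have T_later: "T \<in> sets (H s)" if "t < s" for s
    proof -
      have "Measurable.pred (H s) (\<lambda>\<omega>. \<forall>r\<in>{r\<in>D0. t < r \<and> r \<le> s}. \<exists>q\<in>{q\<in>D. q < r}. \<omega> \<in> C q)"
      proof (intro measurable_pred_countable countable_Collect D0(1) D)
        fix r q assume "r \<in> {r\<in>D0. t < r \<and> r \<le> s}" "q \<in> {q\<in>D. q < r}"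
        then have "C q \<in> sets (H s)" by (intro C_mono) auto
        then show "Measurable.pred (H s) (\<lambda>\<omega>. \<omega> \<in> C q)" by simp
      qed
      then show ?thesis
        unfolding T_def \<rho>_le_iff[OF that] pred_def space_F .
    qed
    have TM: "T \<in> sets M" using T_later[of \<top>] False HM by (auto simp: less_top)
    have V: "V \<in> sets (H t)"
      unfolding V_def using CD C_mono by (intro sets.countable_UN') auto
    have "V \<subseteq> T"
      using sets.sets_into_space[OF C] by (auto simp: V_def T_def \<rho>_def space_F intro: Inf_lower2)
    have late: "C t - T \<in> null_sets M"
    proof (rule null_sets_subset)
      show "(\<Union>r\<in>{r\<in>D0. t < r}. C t - (\<Union>q\<in>J r. C q)) \<in> null_sets M"
        using J(3) D0(1) by (intro null_sets_UN' countable_Collect) auto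
      show "C t - T \<in> sets M" using CM TM by simp
      \<comment> \<open>If \<open>\<rho>\<close> exceeds \<open>t\<close>, some \<open>r > t\<close>
        in \<open>D0\<close> has no \<open>q < r\<close> in \<open>D\<close> with
        \<open>\<omega>\<close> in \<open>C q\<close>, in particular none in \<open>J r\<close>. So
        \<open>\<omega>\<close> is in the part of \<open>C t\<close> that \<open>J r\<close> leaves
        uncovered.\<close>
      show "C t - T \<subseteq> (\<Union>r\<in>{r\<in>D0. t < r}. C t - (\<Union>q\<in>J r. C q))"
      proof
        fix \<omega> assume \<omega>: "\<omega> \<in> C t - T"
        then have "\<not> \<rho> \<omega> \<le> t" using sets.sets_into_space[OF C] by (auto simp: T_def space_F)
        then obtain r where r: "r \<in> D0" "t < r" "\<not> (\<exists>q\<in>{q\<in>D. q < r}. \<omega> \<in> C q)"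
          using \<rho>_le_iff[of t \<top> \<omega>] False by (auto simp: less_top)
        moreover have "J r \<subseteq> {q\<in>D. q < r}" using J(2) r(1) by (auto simp: D_def)
        ultimately show "\<omega> \<in> (\<Union>r\<in>{r\<in>D0. t < r}. C t - (\<Union>q\<in>J r. C q))" using \<omega> by auto
      qed
    qed
    have R_later: "R \<in> sets (H s)" if "t < s" for s
    proof -
      have "V \<in> sets (H s)" "C t \<in> sets (H s)"
        using V C_mono[OF less_imp_le[OF that]] sets_F_mono[OF less_imp_le[OF that]] by blast+
      then show ?thesis unfolding R_def using T_later[OF that] by (intro sets.Diff)
    qed
    then have RM: "R \<in> sets M" using False HM by (auto simp: less_top)
    \<comment> \<open>\<open>R\<close> is not known to lie in \<open>H t\<close>, but it lies in every later \<open>H q\<close>, where minimality of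
      \<open>C q\<close> applies.\<close>
    have "R \<inter> Q t \<in> null_sets M"
    proof (rule null_sets_subset)
      show "N \<union> (Q t - U t) \<in> null_sets M" using N U(2) by blast
      show "R \<inter> Q t \<in> sets M" using RM Q by simp
      \<comment> \<open>Before \<open>\<zeta>\<close> the lower bound on \<open>\<rho>\<close> gives
        \<open>\<tau> \<omega> \<le> t\<close>, so \<open>\<omega>\<close> is in \<open>B t\<close>;
        as it is not in \<open>C t\<close>, the hull \<open>U t\<close> misses it.\<close>
      show "R \<inter> Q t \<subseteq> N \<union> (Q t - U t)"
        using \<rho>_lower B(2)[of _ t] by (fastforce simp: R_def T_def Q_def C_def min_def split: if_splits)
    qed
    have RC: "R \<inter> C q \<in> null_sets M" if "t < q" for q
    proof -
      have "R \<inter> Q q \<in> null_sets M"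
        using \<open>R \<inter> Q t \<in> null_sets M\<close> RM Q that
        by (elim null_sets_subset) (auto simp: Q_def)
      then have "R \<inter> U q \<in> null_sets M" using U(3) R_later[OF that] by blast
      then show ?thesis
        using RM CM by (elim null_sets_subset) (auto simp: C_def)
    qed
    \<comment> \<open>Where \<open>\<rho>\<close> is below \<infinity>, some time of
      \<open>D\<close> witnesses it; on \<open>R\<close> that time is after \<open>t\<close>, since
      \<open>V\<close> has been removed.\<close>
    have "R = (\<Union>q\<in>{q\<in>D. t < q}. R \<inter> C q)"
    proof (intro equalityI subsetI)
      fix \<omega> assume \<omega>: "\<omega> \<in> R"
      then have "\<rho> \<omega> < \<top>" using False by (auto simp: R_def T_def less_top intro: le_less_trans)
      then obtain q where q: "q \<in> D" "\<omega> \<in> C q"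
        unfolding \<rho>_def using Inf_less_iff[of "{q\<in>D. \<omega> \<in> C q}"] by auto
      with \<omega> have "t < q" by (auto simp: R_def V_def not_le[symmetric])
      with q \<omega> show "\<omega> \<in> (\<Union>q\<in>{q\<in>D. t < q}. R \<inter> C q)" by auto
    qed auto
    also have "\<dots> \<in> null_sets M"
      using RC CD by (intro null_sets_UN') auto
    finally have "R \<in> null_sets M" .
    have "T = ((V \<union> C t) - (C t - T)) \<union> R"
      using \<open>V \<subseteq> T\<close> by (auto simp: R_def)
    also have "\<dots> \<in> sets (H t)"
      using V C \<open>R \<in> null_sets M\<close> late null by blast
    finally show ?thesis by (simp add: T_def)
  qed

  \<comment> \<open>The upper bound on \<open>\<rho>\<close> may fail on \<open>N\<close>. Using
    \<open>\<tau>\<close> there makes both relations hold at every point, and adaptedness survives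
    because the change only involves null sets, which lie in each \<open>H t\<close>.\<close>
  define \<sigma> where "\<sigma> \<omega> = (if \<omega> \<in> N then \<tau> \<omega> else \<rho> \<omega>)" for \<omega>
  have "stopping_time H \<sigma>"
  proof
    fix t
    have "{\<omega>\<in>space M. \<sigma> \<omega> \<le> t} = ({\<omega>\<in>space M. \<rho> \<omega> \<le> t} - N) \<union> (N \<inter> {\<omega>\<in>space M. \<tau> \<omega> \<le> t})"
      by (auto simp: \<sigma>_def)
    also have "\<dots> \<in> sets (H t)"
    proof -
      have "N \<inter> {\<omega>\<in>space M. \<tau> \<omega> \<le> t} \<in> null_sets M"
        using N by (rule null_set_Int2) simp
      then show ?thesis using N T null by blast
    qed
    finally show "Measurable.pred (H t) (\<lambda>\<omega>. \<sigma> \<omega> \<le> t)"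
      by (simp add: pred_def space_F)
  qed
  moreover have "(\<tau> \<omega> < \<zeta> \<omega> \<longrightarrow> \<sigma> \<omega> = \<tau> \<omega>) \<and> (\<zeta> \<omega> \<le> \<tau> \<omega> \<longrightarrow> \<zeta> \<omega> \<le> \<sigma> \<omega>)"
    if "\<omega> \<in> space M" for \<omega>
    using \<rho>_lower[OF that] \<rho>_upper[OF that]
    by (auto simp: \<sigma>_def min_def not_less intro!: antisym split: if_splits)
  ultimately show ?thesis by blast
qed

text \<open>On the event that \<open>T\<close> is at most \<open>t\<close>, the opposite relation is
  witnessed by some \<open>s\<close> in a countable separating set with
  \<open>S \<omega> \<le> s\<close> and \<open>s < T \<omega>\<close>. Such an \<open>s\<close> is
  below \<open>t\<close>, so \<open>F t\<close> decides the matter.\<close>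

lemma (in filtration) stopping_time_le:
  assumes T: "stopping_time F T" and S: "stopping_time F S"
  shows "Measurable.pred (pre_sigma T) (\<lambda>\<omega>. T \<omega> \<le> S \<omega>)"
proof (rule pred_pre_sigmaI[OF T])
  fix t
  obtain D :: "'t set"
    where [simp]: "countable D" and D: "\<And>x y. x < y \<Longrightarrow> (\<exists>b\<in>D. x \<le> b \<and> b < y)"
    using countable_separating_set_linorder2 by auto
  show "Measurable.pred (F t) (\<lambda>\<omega>. T \<omega> \<le> S \<omega> \<and> T \<omega> \<le> t)"
  proof (rule measurable_cong[THEN iffD2])
    show "(T \<omega> \<le> S \<omega> \<and> T \<omega> \<le> t) \<longleftrightarrow>
        T \<omega> \<le> t \<and> \<not> (\<exists>s\<in>{s\<in>D. s \<le> t}. S \<omega> \<le> s \<and> \<not> T \<omega> \<le> s)" for \<omega>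
      using D[of "S \<omega>" "T \<omega>"] by (force simp: not_le)
    show "Measurable.pred (F t)
        (\<lambda>\<omega>. T \<omega> \<le> t \<and> \<not> (\<exists>s\<in>{s\<in>D. s \<le> t}. S \<omega> \<le> s \<and> \<not> T \<omega> \<le> s))"
      by (intro pred_intros_logic measurable_pred_countable countable_Collect
          stopping_time_le_const T S) auto
  qed
qed

lemma (in filtration) stopping_time_mono:
  assumes "stopping_time F T" "\<And>t. sets (F t) \<subseteq> sets (G t)" "\<And>t. space (G t) = \<Omega>"
  shows "stopping_time G T"
  unfolding stopping_time_def pred_def assms(3)
  using stopping_timeD[OF assms(1)] assms(2) by (auto simp: pred_def space_F)

section \<open>The progressively enlarged filtrations\<close>

lemma sets_generated_algebra:
  "sets (generated_algebra \<Omega> I X) = sigma_sets \<Omega> (\<Union>i\<in>I. sets (vimage_algebra \<Omega> (X i) borel))"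
  unfolding generated_algebra_def
  using sets.space_closed[of "vimage_algebra \<Omega> _ borel"]
  by (intro sets_measure_of) fastforce

lemma space_generated_algebra: "space (generated_algebra \<Omega> I X) = \<Omega>"
  unfolding generated_algebra_def by (rule space_measure_of_conv)

lemma generated_algebra_closed: "sets (generated_algebra \<Omega> I X) \<subseteq> Pow \<Omega>"
  using sets.space_closed[of "generated_algebra \<Omega> I X"] by (simp add: space_generated_algebra)

lemma sets_generated_algebra_subset:
  assumes "space N = \<Omega>" "\<And>i. i \<in> I \<Longrightarrow> X i \<in> borel_measurable N"
  shows "sets (generated_algebra \<Omega> I X) \<subseteq> sets N"
  unfolding sets_generated_algebra assms(1)[symmetric]
  using assms by (intro sets.sigma_sets_subset UN_least sets_image_in_sets) auto

lemma borel_measurable_generated_algebra: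
  fixes X :: "'i \<Rightarrow> 'a \<Rightarrow> 'b::topological_space"
  assumes "i \<in> I"
  shows "X i \<in> borel_measurable (generated_algebra \<Omega> I X)"
proof (rule measurableI)
  fix A :: "'b set" assume "A \<in> sets borel"
  then have "X i -` A \<inter> \<Omega> \<in> sets (vimage_algebra \<Omega> (X i) borel)"
    by (rule in_vimage_algebra)
  then show "X i -` A \<inter> space (generated_algebra \<Omega> I X) \<in> sets (generated_algebra \<Omega> I X)"
    using assms unfolding sets_generated_algebra
    by (auto simp: space_generated_algebra)
qed simp

lemma sets_completed_natural_filtration:
  "sets (completed_natural_filtration M W t) = sigma_sets (space M)
     (sets (generated_algebra (space M) {u. 0 \<le> u \<and> ennreal u \<le> t} W) \<union> null_sets M)"
  unfolding completed_natural_filtration_def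
  using sets.space_closed[of M] by (intro sets_measure_of Un_least generated_algebra_closed) auto

lemma sets_usual_filtration:
  "sets (usual_filtration M W t) = sigma_sets (space M)
     (\<Inter>s\<in>{s. t < s \<or> s = \<infinity>}. sets (completed_natural_filtration M W s))"
  unfolding usual_filtration_def
  using sets.sets_into_space[of _ "completed_natural_filtration M W \<infinity>"]
  by (intro sets_measure_of) auto

lemma null_sets_subset_usual_filtration: "null_sets M \<subseteq> sets (usual_filtration M W t)"
  unfolding sets_usual_filtration sets_completed_natural_filtration by blast

lemma sets_usual_filtration_mono:
  assumes "s \<le> t"
  shows "sets (usual_filtration M W s) \<subseteq> sets (usual_filtration M W t)"
  unfolding sets_usual_filtration
  using assms by (intro sigma_sets_mono' INF_superset_mono) auto

lemma sets_usual_filtration_subset: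
  fixes W :: "real \<Rightarrow> 'a \<Rightarrow> 'b::topological_space"
  assumes "\<And>u. 0 \<le> u \<Longrightarrow> W u \<in> borel_measurable M"
  shows "sets (usual_filtration M W t) \<subseteq> sets M"
proof -
  have "sets (completed_natural_filtration M W \<infinity>) \<subseteq> sets M"
    unfolding sets_completed_natural_filtration
    using assms by (intro sets.sigma_sets_subset Un_least sets_generated_algebra_subset) auto
  then show ?thesis
    unfolding sets_usual_filtration by (intro sets.sigma_sets_subset) auto
qed

lemma sets_jump_filtration:
  "sets (jump_filtration \<Omega> \<zeta> \<l> k t) = sigma_sets \<Omega> (\<Union>i\<in>{1..k}.
       sets (generated_algebra \<Omega> {s. 0 \<le> s \<and> ennreal s \<le> t}
         (\<lambda>s \<omega>. indicator {\<omega>'. \<zeta> i \<omega>' \<le> ennreal s} \<omega> :: real)) \<union>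
       sets (generated_algebra \<Omega> {s. 0 \<le> s \<and> ennreal s \<le> t}
         (\<lambda>s \<omega>. indicator {\<omega>'. \<zeta> i \<omega>' \<le> ennreal s} \<omega> *\<^sub>R \<l> i \<omega>)))"
  unfolding jump_filtration_def by (intro sets_measure_of UN_least Un_least generated_algebra_closed)

lemma sets_enlarged_filtration:
  "sets (enlarged_filtration M W \<zeta> \<l> k t) = sigma_sets (space M)
     (sets (usual_filtration M W t) \<union> sets (jump_filtration (space M) \<zeta> \<l> k t))"
  unfolding enlarged_filtration_def
  using sets.space_closed[of "usual_filtration M W t"]
    sets.space_closed[of "jump_filtration (space M) \<zeta> \<l> k t"]
  by (intro sets_measure_of Un_least) simp_all

lemma usual_filtration_subset_enlarged_filtration:
  "sets (usual_filtration M W t) \<subseteq> sets (enlarged_filtration M W \<zeta> \<l> k t)"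
  unfolding sets_enlarged_filtration by blast

lemma borel_measurable_enlarged_filtration:
  assumes "i \<in> {1..k}" "0 \<le> s" "ennreal s \<le> t"
  shows "(\<lambda>\<omega>. indicator {\<omega>'. \<zeta> i \<omega>' \<le> ennreal s} \<omega> :: real)
      \<in> borel_measurable (enlarged_filtration M W \<zeta> \<l> k t)" (is "?X s \<in> _")
    and "(\<lambda>\<omega>. indicator {\<omega>'. \<zeta> i \<omega>' \<le> ennreal s} \<omega> *\<^sub>R \<l> i \<omega>)
      \<in> borel_measurable (enlarged_filtration M W \<zeta> \<l> k t)" (is "?Y s \<in> _")
proof -
  let ?E = "enlarged_filtration M W \<zeta> \<l> k t" and ?I = "{s. 0 \<le> s \<and> ennreal s \<le> t}"
  have s: "s \<in> ?I" using assms by simp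
  have "sets (generated_algebra (space M) ?I ?X) \<subseteq> sets ?E"
    "sets (generated_algebra (space M) ?I ?Y) \<subseteq> sets ?E"
    using assms(1) unfolding sets_enlarged_filtration sets_jump_filtration by blast+
  then have "subalgebra ?E (generated_algebra (space M) ?I ?X)"
    "subalgebra ?E (generated_algebra (space M) ?I ?Y)"
    by (auto simp: subalgebra_def space_generated_algebra)
  then show "?X s \<in> borel_measurable ?E" "?Y s \<in> borel_measurable ?E"
    using borel_measurable_generated_algebra[OF s, of ?X] borel_measurable_generated_algebra[OF s, of ?Y]
    by (auto intro: measurable_from_subalg)
qed

lemma sets_enlarged_filtration_subset:
  assumes "space N = space M" "sets (usual_filtration M W t) \<subseteq> sets N"
    and "\<And>i s. i \<in> {1..k} \<Longrightarrow> 0 \<le> s \<Longrightarrow> ennreal s \<le> t \<Longrightarrow>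
      (\<lambda>\<omega>. indicator {\<omega>'. \<zeta> i \<omega>' \<le> ennreal s} \<omega> :: real) \<in> borel_measurable N"
    and "\<And>i s. i \<in> {1..k} \<Longrightarrow> 0 \<le> s \<Longrightarrow> ennreal s \<le> t \<Longrightarrow>
      (\<lambda>\<omega>. indicator {\<omega>'. \<zeta> i \<omega>' \<le> ennreal s} \<omega> *\<^sub>R \<l> i \<omega>) \<in> borel_measurable N"
  shows "sets (enlarged_filtration M W \<zeta> \<l> k t) \<subseteq> sets N"
  unfolding sets_enlarged_filtration sets_jump_filtration assms(1)[symmetric]
  using assms
  by (intro sets.sigma_sets_subset Un_least UN_least sets_generated_algebra_subset) auto

lemma sets_enlarged_filtration_mono:
  assumes "j \<le> k" "s \<le> t"
  shows "sets (enlarged_filtration M W \<zeta> \<l> j s) \<subseteq> sets (enlarged_filtration M W \<zeta> \<l> k t)"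
proof (rule sets_enlarged_filtration_subset)
  show "sets (usual_filtration M W s) \<subseteq> sets (enlarged_filtration M W \<zeta> \<l> k t)"
    using sets_usual_filtration_mono[OF assms(2)] usual_filtration_subset_enlarged_filtration
    by (rule order_trans)
qed (use assms in \<open>auto intro!: borel_measurable_enlarged_filtration\<close>)

lemma filtration_enlarged_filtration: "filtration (space M) (enlarged_filtration M W \<zeta> \<l> k)"
  by unfold_locales (simp_all add: sets_enlarged_filtration_mono)

lemma sets_enlarged_filtration_subset_sets:
  assumes "\<And>u. 0 \<le> u \<Longrightarrow> W u \<in> borel_measurable M"
    and "\<And>i. i \<in> {1..k} \<Longrightarrow> \<zeta> i \<in> borel_measurable M"
    and "\<And>i. i \<in> {1..k} \<Longrightarrow> \<l> i \<in> borel_measurable M"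
  shows "sets (enlarged_filtration M W \<zeta> \<l> k t) \<subseteq> sets M"
proof (rule sets_enlarged_filtration_subset)
  fix i and s :: real assume i: "i \<in> {1..k}"
  note [measurable] = assms(2,3)[OF i]
  show ind: "(\<lambda>\<omega>. indicator {\<omega>'. \<zeta> i \<omega>' \<le> ennreal s} \<omega> :: real) \<in> borel_measurable M"
    unfolding indicator_def mem_Collect_eq by measurable
  show "(\<lambda>\<omega>. indicator {\<omega>'. \<zeta> i \<omega>' \<le> ennreal s} \<omega> *\<^sub>R \<l> i \<omega>) \<in> borel_measurable M"
    using ind by measurable
next
  show "sets (usual_filtration M W t) \<subseteq> sets M"
    by (rule sets_usual_filtration_subset) (rule assms(1))
qed (rule refl)

lemma stopping_time_jump:
  assumes "i \<in> {1..k}"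
  shows "stopping_time (enlarged_filtration M W \<zeta> \<l> k) (\<zeta> i)"
proof -
  have "{\<omega>\<in>space M. \<zeta> i \<omega> \<le> ennreal t} \<in> sets (enlarged_filtration M W \<zeta> \<l> k (ennreal t))"
    (is "?A \<in> sets ?E") if "0 \<le> t" for t :: real
  proof -
    let ?X = "\<lambda>\<omega>. indicator {\<omega>'. \<zeta> i \<omega>' \<le> ennreal t} \<omega> :: real"
    have "?X \<in> borel_measurable ?E"
      using assms that by (intro borel_measurable_enlarged_filtration) auto
    then have "?X -` {1} \<inter> space ?E \<in> sets ?E"
      by (rule measurable_sets) simp
    also have "?X -` {1} \<inter> space ?E = ?A"
      by (auto simp: indicator_def)
    finally show ?thesis .
  qed
  then show ?thesis
    by (subst stopping_time_ennreal_iff[OF space_enlarged_filtration]) blast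
qed

text \<open>These are the good sets of the trace argument, indistinguishable on \<open>Q\<close>
  from a member of \<open>N\<close>. \<open>Q\<close> may be any set, measurable or not.\<close>

lemma sigma_algebra_trace:
  assumes "space N = \<Omega>"
  shows "sigma_algebra \<Omega> {A. A \<subseteq> \<Omega> \<and> (\<exists>B\<in>sets N. A \<inter> Q = B \<inter> Q)}"
  unfolding sigma_algebra_iff2
proof (intro conjI ballI allI impI)
  fix A assume "A \<in> {A. A \<subseteq> \<Omega> \<and> (\<exists>B\<in>sets N. A \<inter> Q = B \<inter> Q)}"
  then obtain B where B: "A \<subseteq> \<Omega>" "B \<in> sets N" "A \<inter> Q = B \<inter> Q" by blast
  then have "(\<Omega> - A) \<inter> Q = (space N - B) \<inter> Q" using assms by blast
  with B show "\<Omega> - A \<in> {A. A \<subseteq> \<Omega> \<and> (\<exists>B\<in>sets N. A \<inter> Q = B \<inter> Q)}" by blast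
next
  fix A :: "nat \<Rightarrow> 'a set"
  assume A: "range A \<subseteq> {A. A \<subseteq> \<Omega> \<and> (\<exists>B\<in>sets N. A \<inter> Q = B \<inter> Q)}"
  then have "\<forall>i. \<exists>B\<in>sets N. A i \<inter> Q = B \<inter> Q" by blast
  then obtain B where "\<And>i. B i \<in> sets N" "\<And>i. A i \<inter> Q = B i \<inter> Q" by metis
  then have "(\<Union>i. A i) \<inter> Q = (\<Union>i. B i) \<inter> Q" "(\<Union>i. B i) \<in> sets N" by auto
  with A show "(\<Union>i. A i) \<in> {A. A \<subseteq> \<Omega> \<and> (\<exists>B\<in>sets N. A \<inter> Q = B \<inter> Q)}" by blast
qed auto

text \<open>On \<open>Q\<close> the jumps of index above \<open>k\<close> come after
  \<open>t\<close>, so their generators up to time \<open>t\<close> vanish there. Hence all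
  generators are measurable for the sigma-algebra of sets that agree on \<open>Q\<close> with a set
  known from the first \<open>k\<close> jumps.\<close>

lemma enlarged_filtration_trace:
  assumes later: "\<And>i \<omega>. k < i \<Longrightarrow> i \<le> n \<Longrightarrow> \<omega> \<in> Q \<Longrightarrow> t < \<zeta> i \<omega>"
    and Q: "Q \<subseteq> space M" and A: "A \<in> sets (enlarged_filtration M W \<zeta> \<l> n t)"
  shows "\<exists>B\<in>sets (enlarged_filtration M W \<zeta> \<l> k t). A \<inter> Q = B \<inter> Q"
proof -
  let ?E = "enlarged_filtration M W \<zeta> \<l> k t"
  define N where "N = sigma (space M) {A. A \<subseteq> space M \<and> (\<exists>B\<in>sets ?E. A \<inter> Q = B \<inter> Q)}"
  have sets_N: "sets N = {A. A \<subseteq> space M \<and> (\<exists>B\<in>sets ?E. A \<inter> Q = B \<inter> Q)}"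
    unfolding N_def by (intro sigma_algebra.sets_measure_of_eq sigma_algebra_trace) simp
  have space_N: "space N = space M"
    unfolding N_def by (rule space_measure_of_conv)
  have sub: "subalgebra N ?E"
    using sets.sets_into_space[of _ ?E] by (auto simp: subalgebra_def space_N sets_N)
  \<comment> \<open>A preimage under such an \<open>f\<close> agrees on \<open>Q\<close> with the
    whole space or with the empty set.\<close>
  have const: "f \<in> borel_measurable N" if "\<And>\<omega>. \<omega> \<in> Q \<Longrightarrow> f \<omega> = c"
    for f :: "'a \<Rightarrow> 'x::topological_space" and c
  proof (rule measurableI)
    fix S :: "'x set"
    have "(f -` S \<inter> space M) \<inter> Q = (if c \<in> S then space M else {}) \<inter> Q"
      using that Q by auto
    moreover have "(if c \<in> S then space M else {}) \<in> sets ?E"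
      using sets.top[of ?E] by simp
    ultimately show "f -` S \<inter> space N \<in> sets N"
      unfolding space_N sets_N by blast
  qed simp
  have "sets (enlarged_filtration M W \<zeta> \<l> n t) \<subseteq> sets N"
  proof (rule sets_enlarged_filtration_subset)
    show "sets (usual_filtration M W t) \<subseteq> sets N"
      using sub usual_filtration_subset_enlarged_filtration[of M W t \<zeta> \<l> k]
      by (auto simp: subalgebra_def)
    fix i and s :: real assume i: "i \<in> {1..n}" and s: "0 \<le> s" "ennreal s \<le> t"
    have zero: "indicator {\<omega>'. \<zeta> i \<omega>' \<le> ennreal s} \<omega> = (0::real)" if "k < i" "\<omega> \<in> Q" for \<omega>
      using later[of i \<omega>] that i s by (auto simp: indicator_def)
    show "(\<lambda>\<omega>. indicator {\<omega>'. \<zeta> i \<omega>' \<le> ennreal s} \<omega> :: real) \<in> borel_measurable N"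
    proof (cases "i \<le> k")
      case True
      then show ?thesis
        using i s by (intro measurable_from_subalg[OF sub] borel_measurable_enlarged_filtration) auto
    next
      case False
      then show ?thesis by (intro const[of _ 0]) (simp add: zero)
    qed
    show "(\<lambda>\<omega>. indicator {\<omega>'. \<zeta> i \<omega>' \<le> ennreal s} \<omega> *\<^sub>R \<l> i \<omega>) \<in> borel_measurable N"
    proof (cases "i \<le> k")
      case True
      then show ?thesis
        using i s by (intro measurable_from_subalg[OF sub] borel_measurable_enlarged_filtration) auto
    next
      case False
      then show ?thesis by (intro const[of _ 0]) (simp add: zero)
    qed
  qed (simp add: space_N)
  with A show ?thesis by (auto simp: sets_N)
qed

section \<open>The decomposition\<close>

text \<open>Here \<open>k\<close> is the first index below \<open>n\<close> whose stopping time
  precedes the next jump, or \<open>n\<close> if there is none. An earlier summand fails its own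
  last condition and a later one fails the condition at index \<open>k\<close>, so exactly one
  indicator is 1.\<close>

lemma decomposition_eq:
  fixes \<sigma> \<zeta> :: "nat \<Rightarrow> 'a \<Rightarrow> ennreal"
  assumes "1 \<le> n" "k \<le> n" and past: "\<And>j. j < k \<Longrightarrow> \<zeta> (Suc j) \<omega> \<le> \<sigma> j \<omega>"
    and cur: "k < n \<Longrightarrow> \<sigma> k \<omega> < \<zeta> (Suc k) \<omega>"
  shows "\<sigma> 0 \<omega> * indicator {\<omega>'. \<sigma> 0 \<omega>' < \<zeta> 1 \<omega>'} \<omega>
      + (\<Sum>k\<in>{1..<n}. \<sigma> k \<omega> *
           indicator {\<omega>'. (\<forall>j<k. \<zeta> (Suc j) \<omega>' \<le> \<sigma> j \<omega>') \<and> \<sigma> k \<omega>' < \<zeta> (Suc k) \<omega>'} \<omega>)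
      + \<sigma> n \<omega> * indicator {\<omega>'. \<forall>j<n. \<zeta> (Suc j) \<omega>' \<le> \<sigma> j \<omega>'} \<omega> = \<sigma> k \<omega>" (is "?a + sum ?f _ + ?b = _")
proof -
  \<comment> \<open>In \<open>ennreal\<close> the product of \<infinity> and 0 is 0, so a vanishing
    indicator removes its summand even where the stopping time is infinite.\<close>
  have a: "?a = (if k = 0 then \<sigma> k \<omega> else 0)"
    using past[of 0] cur assms(1) by (auto simp: indicator_def)
  have "?f j = (if j = k then \<sigma> k \<omega> else 0)" if "j \<in> {1..<n}" for j
    using past[of j] past cur that by (cases j k rule: linorder_cases) (auto simp: indicator_def not_less)
  then have "sum ?f {1..<n} = (\<Sum>j\<in>{1..<n}. if j = k then \<sigma> k \<omega> else 0)"
    by (rule sum.cong[OF refl])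
  also have "\<dots> = (if k \<in> {1..<n} then \<sigma> k \<omega> else 0)"
    by (rule sum.delta) simp
  finally have f: "sum ?f {1..<n} = (if k \<in> {1..<n} then \<sigma> k \<omega> else 0)" .
  have b: "?b = (if k = n then \<sigma> k \<omega> else 0)"
    using past cur assms(2) by (auto simp: indicator_def not_le)
  show ?thesis unfolding a f b using assms(1,2) by auto
qed

theorem theorem2p1:
  fixes M :: "'a measure"
    and W :: "real \<Rightarrow> 'a \<Rightarrow> 'b::euclidean_space"
    and n :: nat
    and \<zeta> :: "nat \<Rightarrow> 'a \<Rightarrow> ennreal"
    and \<l> :: "nat \<Rightarrow> 'a \<Rightarrow> 'e::euclidean_space"
    and E :: "'e set"
    and \<tau> :: "'a \<Rightarrow> ennreal"
  assumes prob: "prob_space M"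
    and BM: "brownian_motion M W"
    and n: "1 \<le> n"
    and jump_times: "\<And>i. i \<in> {1..n} \<Longrightarrow> \<zeta> i \<in> borel_measurable M"
    and ordered: "\<And>i \<omega>. 1 \<le> i \<Longrightarrow> i < n \<Longrightarrow> \<omega> \<in> space M \<Longrightarrow> \<zeta> i \<omega> \<le> \<zeta> (Suc i) \<omega>"
    and E: "E \<in> sets borel"
    and marks: "\<And>i. i \<in> {1..n} \<Longrightarrow> \<l> i \<in> borel_measurable M"
    and marks_in: "\<And>i \<omega>. i \<in> {1..n} \<Longrightarrow> \<omega> \<in> space M \<Longrightarrow> \<l> i \<omega> \<in> E"
    and random_time: "\<tau> \<in> borel_measurable M"
  shows "stopping_time (enlarged_filtration M W \<zeta> \<l> n) \<tau> \<longleftrightarrow>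
    (\<exists>\<sigma> :: nat \<Rightarrow> 'a \<Rightarrow> ennreal.
       stopping_time (usual_filtration M W) (\<sigma> 0) \<and>
       (\<forall>k\<in>{1..n}. stopping_time (enlarged_filtration M W \<zeta> \<l> k) (\<sigma> k) \<and>
          (\<forall>\<omega>\<in>space M. \<zeta> k \<omega> \<le> \<sigma> k \<omega>)) \<and>
       (\<forall>\<omega>\<in>space M.
          \<tau> \<omega> = \<sigma> 0 \<omega> * indicator {\<omega>'. \<sigma> 0 \<omega>' < \<zeta> 1 \<omega>'} \<omega>
            + (\<Sum>k\<in>{1..<n}. \<sigma> k \<omega> *
                 indicator {\<omega>'. (\<forall>j<k. \<zeta> (Suc j) \<omega>' \<le> \<sigma> j \<omega>') \<and> \<sigma> k \<omega>' < \<zeta> (Suc k) \<omega>'} \<omega>)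
            + \<sigma> n \<omega> * indicator {\<omega>'. \<forall>j<n. \<zeta> (Suc j) \<omega>' \<le> \<sigma> j \<omega>'} \<omega>))"
proof -
  define G where "G = enlarged_filtration M W \<zeta> \<l>"
  interpret M: prob_space M by fact
  have G: "filtration (space M) (G k)" for k
    unfolding G_def by (rule filtration_enlarged_filtration)
  have G_mono: "sets (G j t) \<subseteq> sets (G k t)" if "j \<le> k" for j k t
    unfolding G_def using that by (intro sets_enlarged_filtration_mono) auto
  have space_G: "space (G k t) = space M" for k t by (simp add: G_def)
  have "W u \<in> borel_measurable M" if "0 \<le> u" for u
    using BM that by (auto simp: brownian_motion_def)
  then have G_sets: "sets (G k t) \<subseteq> sets M" if "k \<le> n" for k t
    unfolding G_def using that jump_times marks
    by (intro sets_enlarged_filtration_subset_sets) auto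
  have G_null: "null_sets M \<subseteq> sets (G k t)" for k t
    unfolding G_def
    using null_sets_subset_usual_filtration usual_filtration_subset_enlarged_filtration by (rule order_trans)
  have G_0: "stopping_time (usual_filtration M W) T \<longleftrightarrow> stopping_time (G 0) T" for T
    by (simp add: stopping_time_def pred_def G_def sets_enlarged_filtration_0)
  have jump: "stopping_time (G k) (\<zeta> i)" if "1 \<le> i" "i \<le> k" for i k
    unfolding G_def using that by (intro stopping_time_jump) auto
  have \<zeta>_mono: "\<zeta> i \<omega> \<le> \<zeta> j \<omega>" if "1 \<le> i" "i \<le> j" "j \<le> n" "\<omega> \<in> space M" for i j \<omega>
    using that(2,3)
  proof (induction j rule: dec_induct)
    case (step j)
    with ordered[of j \<omega>] that show ?case by (auto intro: order_trans)
  qed simp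

  \<comment> \<open>From the decomposition to the stopping time\<close>
  have backward: "stopping_time (G n) \<tau>"
    if \<sigma>: "stopping_time (G 0) (\<sigma> 0)"
      "\<forall>k\<in>{1..n}. stopping_time (G k) (\<sigma> k) \<and> (\<forall>\<omega>\<in>space M. \<zeta> k \<omega> \<le> \<sigma> k \<omega>)"
      "\<forall>\<omega>\<in>space M.
          \<tau> \<omega> = \<sigma> 0 \<omega> * indicator {\<omega>'. \<sigma> 0 \<omega>' < \<zeta> 1 \<omega>'} \<omega>
            + (\<Sum>k\<in>{1..<n}. \<sigma> k \<omega> *
                 indicator {\<omega>'. (\<forall>j<k. \<zeta> (Suc j) \<omega>' \<le> \<sigma> j \<omega>') \<and> \<sigma> k \<omega>' < \<zeta> (Suc k) \<omega>'} \<omega>)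
            + \<sigma> n \<omega> * indicator {\<omega>'. \<forall>j<n. \<zeta> (Suc j) \<omega>' \<le> \<sigma> j \<omega>'} \<omega>"
    for \<sigma> :: "nat \<Rightarrow> 'a \<Rightarrow> ennreal"
  proof -
    interpret filtration "space M" "G n" by (rule G)
    have \<sigma>n: "stopping_time (G n) (\<sigma> k)" if "k \<le> n" for k
    proof (rule filtration.stopping_time_mono[OF G])
      show "stopping_time (G k) (\<sigma> k)" using \<sigma>(1,2) that by (cases "k = 0") auto
    qed (use G_mono that in \<open>auto simp: space_G\<close>)
    \<comment> \<open>\<open>P k\<close> selects the summand of index \<open>k\<close>; the last
      summand has no upper condition.\<close>
    define P where "P k \<omega> \<longleftrightarrow> (\<forall>j\<in>{..<k}. \<zeta> (Suc j) \<omega> \<le> \<sigma> j \<omega>) \<and> (k < n \<longrightarrow> \<sigma> k \<omega> < \<zeta> (Suc k) \<omega>)"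
      for k \<omega>
    have P: "Measurable.pred (pre_sigma (\<sigma> k)) (P k)" if k: "k \<le> n" for k
    proof -
      \<comment> \<open>The bound of \<open>\<sigma> k\<close> below by \<open>\<zeta> k\<close>
        enters here. The comparison of \<open>\<zeta> (Suc j)\<close> with \<open>\<sigma> j\<close>
        is settled at time \<open>\<zeta> (Suc j)\<close>, which for \<open>j < k\<close> is at most
        \<open>\<zeta> k\<close> and hence at most \<open>\<sigma> k\<close>.\<close>
      have past: "Measurable.pred (pre_sigma (\<sigma> k)) (\<lambda>\<omega>. \<zeta> (Suc j) \<omega> \<le> \<sigma> j \<omega>)"
        if j: "j \<in> {..<k}" for j
      proof -
        have "\<zeta> (Suc j) \<omega> \<le> \<sigma> k \<omega>" if "\<omega> \<in> space M" for \<omega>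
          using \<zeta>_mono[of "Suc j" k \<omega>] \<sigma>(2) that j k by (auto intro: order_trans)
        then have "sets (pre_sigma (\<zeta> (Suc j))) \<subseteq> sets (pre_sigma (\<sigma> k))"
          using j k by (intro mono_pre_sigma \<sigma>n jump) auto
        moreover have "Measurable.pred (pre_sigma (\<zeta> (Suc j))) (\<lambda>\<omega>. \<zeta> (Suc j) \<omega> \<le> \<sigma> j \<omega>)"
          using j k by (intro stopping_time_le \<sigma>n jump) auto
        ultimately show ?thesis
          by (auto simp: pred_def space_pre_sigma)
      qed
      have cur: "Measurable.pred (pre_sigma (\<sigma> k)) (\<lambda>\<omega>. k < n \<longrightarrow> \<sigma> k \<omega> < \<zeta> (Suc k) \<omega>)"
        using k by (cases "k < n") (auto intro!: stopping_time_less \<sigma>n jump)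
      show ?thesis
        unfolding P_def by (rule pred_intros_logic(3)[OF measurable_pred_countable(1)[OF _ past] cur]) simp_all
    qed
    have \<tau>_eq: "\<tau> \<omega> = \<sigma> k \<omega>" if "\<omega> \<in> space M" "k \<le> n" "P k \<omega>" for k \<omega>
      using decomposition_eq[of n k \<zeta> \<omega> \<sigma>] \<sigma>(3) that n by (auto simp: P_def)
    have ex: "\<exists>k\<in>{..n}. P k \<omega>" for \<omega>
    proof -
      define k where "k = (LEAST k. k = n \<or> \<sigma> k \<omega> < \<zeta> (Suc k) \<omega>)"
      have "k = n \<or> \<sigma> k \<omega> < \<zeta> (Suc k) \<omega>" unfolding k_def by (rule LeastI[of _ n]) simp
      moreover have "k \<le> n" unfolding k_def by (rule Least_le) simp
      moreover have "\<zeta> (Suc j) \<omega> \<le> \<sigma> j \<omega>" if "j < k" for j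
        using not_less_Least[of j "\<lambda>k. k = n \<or> \<sigma> k \<omega> < \<zeta> (Suc k) \<omega>"] that
        by (auto simp: k_def not_less)
      ultimately show ?thesis by (auto simp: P_def intro!: bexI[of _ k])
    qed
    show ?thesis
    proof
      fix t
      \<comment> \<open>As \<open>P k\<close> is known at time \<open>\<sigma> k\<close>, its part
        with \<open>\<sigma> k \<omega> \<le> t\<close> is known at \<open>t\<close>.\<close>
      have "(\<Union>k\<in>{..n}. {\<omega>\<in>{\<omega>\<in>space M. P k \<omega>}. \<sigma> k \<omega> \<le> t}) \<in> sets (G n t)"
        using P by (intro sets.finite_UN sets_pre_sigmaD \<sigma>n) (auto simp: pred_def space_pre_sigma)
      also have "(\<Union>k\<in>{..n}. {\<omega>\<in>{\<omega>\<in>space M. P k \<omega>}. \<sigma> k \<omega> \<le> t}) = {\<omega>\<in>space M. \<tau> \<omega> \<le> t}"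
        using ex \<tau>_eq by fastforce
      finally show "Measurable.pred (G n t) (\<lambda>\<omega>. \<tau> \<omega> \<le> t)"
        by (simp add: pred_def space_G)
    qed
  qed

  \<comment> \<open>From the stopping time to the decomposition\<close>
  have forward: "\<exists>\<sigma> :: nat \<Rightarrow> 'a \<Rightarrow> ennreal.
       stopping_time (G 0) (\<sigma> 0) \<and>
       (\<forall>k\<in>{1..n}. stopping_time (G k) (\<sigma> k) \<and> (\<forall>\<omega>\<in>space M. \<zeta> k \<omega> \<le> \<sigma> k \<omega>)) \<and>
       (\<forall>\<omega>\<in>space M.
          \<tau> \<omega> = \<sigma> 0 \<omega> * indicator {\<omega>'. \<sigma> 0 \<omega>' < \<zeta> 1 \<omega>'} \<omega>
            + (\<Sum>k\<in>{1..<n}. \<sigma> k \<omega> *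
                 indicator {\<omega>'. (\<forall>j<k. \<zeta> (Suc j) \<omega>' \<le> \<sigma> j \<omega>') \<and> \<sigma> k \<omega>' < \<zeta> (Suc k) \<omega>'} \<omega>)
            + \<sigma> n \<omega> * indicator {\<omega>'. \<forall>j<n. \<zeta> (Suc j) \<omega>' \<le> \<sigma> j \<omega>'} \<omega>)"
    if \<tau>: "stopping_time (G n) \<tau>"
  proof -
    have "\<exists>\<rho>. stopping_time (G k) \<rho> \<and> (\<forall>\<omega>\<in>space M.
        (\<tau> \<omega> < \<zeta> (Suc k) \<omega> \<longrightarrow> \<rho> \<omega> = \<tau> \<omega>) \<and> (\<zeta> (Suc k) \<omega> \<le> \<tau> \<omega> \<longrightarrow> \<zeta> (Suc k) \<omega> \<le> \<rho> \<omega>))"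
      if k: "k < n" for k
    proof (rule stopping_time_before[OF M.finite_measure_axioms G _ G_null random_time])
      fix t
      have "{\<omega>\<in>space M. \<tau> \<omega> \<le> t} \<in> sets (G n t)"
        using stopping_timeD[OF \<tau>] by (simp add: pred_def space_G)
      \<comment> \<open>Jump times are ordered, so before the jump of index \<open>Suc k\<close> all
        later jumps are still to come and the trace lemma applies.\<close>
      then have "\<exists>B\<in>sets (G k t). {\<omega>\<in>space M. \<tau> \<omega> \<le> t} \<inter> {\<omega>\<in>space M. t < \<zeta> (Suc k) \<omega>}
          = B \<inter> {\<omega>\<in>space M. t < \<zeta> (Suc k) \<omega>}"
        unfolding G_def using \<zeta>_mono[of "Suc k"]
        by (elim enlarged_filtration_trace[rotated 2]) (fastforce intro: less_le_trans)+
      then show "\<exists>B\<in>sets (G k t). \<forall>\<omega>\<in>space M. t < \<zeta> (Suc k) \<omega> \<longrightarrow> (\<omega> \<in> B \<longleftrightarrow> \<tau> \<omega> \<le> t)"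
        by (elim bexE) (rule bexI, auto)
    qed (use k jump_times G_sets[of k] in auto)
    then obtain \<rho> where \<rho>: "\<And>k. k < n \<Longrightarrow> stopping_time (G k) (\<rho> k)"
      "\<And>k \<omega>. k < n \<Longrightarrow> \<omega> \<in> space M \<Longrightarrow> \<tau> \<omega> < \<zeta> (Suc k) \<omega> \<Longrightarrow> \<rho> k \<omega> = \<tau> \<omega>"
      "\<And>k \<omega>. k < n \<Longrightarrow> \<omega> \<in> space M \<Longrightarrow> \<zeta> (Suc k) \<omega> \<le> \<tau> \<omega> \<Longrightarrow> \<zeta> (Suc k) \<omega> \<le> \<rho> k \<omega>"
      by metis
    \<comment> \<open>At index \<open>n\<close> there is no further jump and \<open>\<tau>\<close>
      itself serves. The maximum then enforces the lower bound \<open>\<zeta> k\<close>; index 0 has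
      no such bound.\<close>
    define \<rho>' where "\<rho>' k = (if k < n then \<rho> k else \<tau>)" for k
    define \<sigma> where "\<sigma> k = (if k = 0 then \<rho>' 0 else (\<lambda>\<omega>. max (\<rho>' k \<omega>) (\<zeta> k \<omega>)))" for k
    have \<rho>': "stopping_time (G k) (\<rho>' k)" if "k \<le> n" for k
      using \<rho>(1) \<tau> that by (auto simp: \<rho>'_def)
    have \<sigma>: "stopping_time (G k) (\<sigma> k)" if "k \<le> n" for k
      using \<rho>' that by (auto simp: \<sigma>_def intro!: stopping_time_max jump)
    have \<tau>_eq: "\<tau> \<omega> = \<sigma> 0 \<omega> * indicator {\<omega>'. \<sigma> 0 \<omega>' < \<zeta> 1 \<omega>'} \<omega>
            + (\<Sum>k\<in>{1..<n}. \<sigma> k \<omega> *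
                 indicator {\<omega>'. (\<forall>j<k. \<zeta> (Suc j) \<omega>' \<le> \<sigma> j \<omega>') \<and> \<sigma> k \<omega>' < \<zeta> (Suc k) \<omega>'} \<omega>)
            + \<sigma> n \<omega> * indicator {\<omega>'. \<forall>j<n. \<zeta> (Suc j) \<omega>' \<le> \<sigma> j \<omega>'} \<omega>"
      if \<omega>: "\<omega> \<in> space M" for \<omega>
    proof -
      \<comment> \<open>The number of jumps up to and including time
        \<open>\<tau> \<omega>\<close>.\<close>
      define k where "k = (LEAST k. k = n \<or> \<tau> \<omega> < \<zeta> (Suc k) \<omega>)"
      have k: "k = n \<or> \<tau> \<omega> < \<zeta> (Suc k) \<omega>" unfolding k_def by (rule LeastI[of _ n]) simp
      have kn: "k \<le> n" unfolding k_def by (rule Least_le) simp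
      have less: "\<zeta> (Suc j) \<omega> \<le> \<tau> \<omega>" if "j < k" for j
        using not_less_Least[of j "\<lambda>k. k = n \<or> \<tau> \<omega> < \<zeta> (Suc k) \<omega>"] that
        by (auto simp: k_def not_less)
      have "\<rho>' k \<omega> = \<tau> \<omega>" using k kn \<rho>(2) \<omega> by (auto simp: \<rho>'_def)
      \<comment> \<open>For positive \<open>k\<close>, index \<open>k - 1\<close> gives
        \<open>\<zeta> k \<omega> \<le> \<tau> \<omega>\<close>, so the maximum leaves the value
        unchanged.\<close>
      then have \<sigma>k: "\<sigma> k \<omega> = \<tau> \<omega>" using less[of "k - 1"] by (auto simp: \<sigma>_def)
      \<comment> \<open>Where \<open>\<tau>\<close> does not precede the jump, neither does
        \<open>\<rho> j\<close>; thus the conditions on \<open>\<sigma>\<close> select the same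
        index as those on \<open>\<tau>\<close>.\<close>
      have "\<zeta> (Suc j) \<omega> \<le> \<sigma> j \<omega>" if "j < k" for j
        using less[OF that] \<rho>(3)[of j \<omega>] that kn \<omega> by (auto simp: \<sigma>_def \<rho>'_def le_max_iff_disj)
      moreover have "\<sigma> k \<omega> < \<zeta> (Suc k) \<omega>" if "k < n"
        using k \<sigma>k that by simp
      ultimately show ?thesis
        unfolding \<sigma>k[symmetric] using n kn by (intro decomposition_eq[symmetric])
    qed
    show ?thesis
    proof (intro exI[of _ \<sigma>] conjI ballI)
      show "stopping_time (G 0) (\<sigma> 0)" by (rule \<sigma>) simp
      show "stopping_time (G k) (\<sigma> k)" if "k \<in> {1..n}" for k
        using that by (intro \<sigma>) simp
      show "\<zeta> k \<omega> \<le> \<sigma> k \<omega>" if "k \<in> {1..n}" for k \<omega>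
        using that by (simp add: \<sigma>_def)
    qed (rule \<tau>_eq)
  qed

  show ?thesis
    unfolding G_0 G_def[symmetric]
    by (rule iffI, erule forward) (elim exE conjE, rule backward)
qed

end
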